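(* Let $\Gamma$ be a strongly regular graph with parameters $(v,k,\lambda,\mu)$ and restricted eigenvalues $\rho>\sigma$, and let $d$ be an integer with $0\le d\le k$. Then $\mathrm{Rab}_{\geq}(\Gamma,d)\le \lfloor \mathrm{Haem}_{\geq}(\Gamma,d)\rfloor$, and (when $\Gamma$ is connected, which is when $\mathrm{Haem}_{\leq}(\Gamma,d)$ is defined) $\mathrm{Rab}_{\leq}(\Gamma,d)\ge \lceil \mathrm{Haem}_{\leq}(\Gamma,d)\rceil$.
   Context: A graph is strongly regular with parameters $(v,k,\lambda,\mu)$ if it has $v$ vertices, is $k$-regular, is neither complete nor edgeless, every two adjacent vertices have exactly $\lambda$ common neighbours, and every two distinct non-adjacent vertices have exactly $\mu$ common neighbours. Its restricted eigenvalues $\rho>\sigma$ are the two roots of $t^2-(\lambda-\mu)t-(k-\mu)=0$ (the eigenvalues of the adjacency matrix on eigenvectors orthogonal to the all-ones vector); $\rho\ge 0>\sigma$, and $\rho$ is the second largest eigenvalue when $\Gamma$ is connected. Define $\mathrm{Haem}_{\geq}(\Gamma,d)=v\frac{d-\sigma}{k-\sigma}$ and, for connected $\Gamma$, $\mathrm{Haem}_{\leq}(\Gamma,d)=v\frac{d-\rho}{k-\rho}$. The regular adjacency polynomial is $R_\Gamma(x,y,d)=x(x+1)(v-y)-2xyk+(2x+\lambda-\mu+1)yd+y(y-1)\mu-yd^2$. Let $S_d=\{y\in\{d+1,\dots,v\}: R_\Gamma(x,y,d)\ge 0 \text{ for all integers } x\}$; $\mathrm{Rab}_{\geq}(\Gamma,d)=\max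 S_d$ if $S_d\neq\emptyset$, else $0$; $\mathrm{Rab}_{\leq}(\Gamma,d)=\min S_d$ if $S_d\neq\emptyset$, else $v+1$. *)

theory Defs
  imports Complex_Main "Graph_Theory.Graph_Theory"
begin

text \<open>A finite simple graph is, as in Graph\_Theory, a finite loopless symmetric digraph without
  parallel arcs (locale \<^locale>\<open>graph\<close>), so an edge is a pair of opposite arcs and the valency of
  a vertex is its out-degree.\<close>

definition common_neighbours :: "('a, 'b) pre_digraph \<Rightarrow> 'a \<Rightarrow> 'a \<Rightarrow> 'a set" where
  "common_neighbours G a b = {c \<in> verts G. a \<rightarrow>\<^bsub>G\<^esub> c \<and> b \<rightarrow>\<^bsub>G\<^esub> c}"

definition strongly_regular ::
  "('a, 'b) pre_digraph \<Rightarrow> nat \<Rightarrow> nat \<Rightarrow> nat \<Rightarrow> nat \<Rightarrow> bool" where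
  "strongly_regular G v k l \<mu> \<longleftrightarrow>
     graph G \<and> card (verts G) = v \<and>
     (\<forall>a \<in> verts G. out_degree G a = k) \<and>
     \<not> complete_digraph v G \<and> arcs G \<noteq> {} \<and>
     (\<forall>a \<in> verts G. \<forall>b \<in> verts G. a \<rightarrow>\<^bsub>G\<^esub> b \<longrightarrow> card (common_neighbours G a b) = l) \<and>
     (\<forall>a \<in> verts G. \<forall>b \<in> verts G. a \<noteq> b \<and> \<not> a \<rightarrow>\<^bsub>G\<^esub> b \<longrightarrow>
        card (common_neighbours G a b) = \<mu>)"

text \<open>Everything below depends on the graph only through its parameters (and restricted
  eigenvalues), which a strongly regular graph determines uniquely.\<close>

definition restricted_eigenvalues :: "nat \<Rightarrow> nat \<Rightarrow> nat \<Rightarrow> real \<Rightarrow> real \<Rightarrow> bool" where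
  "restricted_eigenvalues k l \<mu> \<rho> \<sigma> \<longleftrightarrow>
     \<rho> > \<sigma> \<and>
     {t :: real. t\<^sup>2 - (real l - real \<mu>) * t - (real k - real \<mu>) = 0} = {\<rho>, \<sigma>}"

definition Haem_ge :: "nat \<Rightarrow> nat \<Rightarrow> real \<Rightarrow> int \<Rightarrow> real" where
  "Haem_ge v k \<sigma> d = real v * ((real_of_int d - \<sigma>) / (real k - \<sigma>))"

text \<open>Meaningful only for connected graphs: otherwise \<open>\<rho> = k\<close> and the denominator vanishes.\<close>

definition Haem_le :: "nat \<Rightarrow> nat \<Rightarrow> real \<Rightarrow> int \<Rightarrow> real" where
  "Haem_le v k \<rho> d = real v * ((real_of_int d - \<rho>) / (real k - \<rho>))"

definition regular_adj_poly ::
  "nat \<Rightarrow> nat \<Rightarrow> nat \<Rightarrow> nat \<Rightarrow> int \<Rightarrow> int \<Rightarrow> int \<Rightarrow> int" where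
  "regular_adj_poly v k l \<mu> x y d =
     x * (x + 1) * (int v - y) - 2 * x * y * int k
     + (2 * x + int l - int \<mu> + 1) * y * d + y * (y - 1) * int \<mu> - y * d\<^sup>2"

definition Rab_set :: "nat \<Rightarrow> nat \<Rightarrow> nat \<Rightarrow> nat \<Rightarrow> int \<Rightarrow> int set" where
  "Rab_set v k l \<mu> d =
     {y \<in> {d + 1 .. int v}. \<forall>x :: int. regular_adj_poly v k l \<mu> x y d \<ge> 0}"

definition Rab_ge :: "nat \<Rightarrow> nat \<Rightarrow> nat \<Rightarrow> nat \<Rightarrow> int \<Rightarrow> int" where
  "Rab_ge v k l \<mu> d = (if Rab_set v k l \<mu> d \<noteq> {} then Max (Rab_set v k l \<mu> d) else 0)"

definition Rab_le :: "nat \<Rightarrow> nat \<Rightarrow> nat \<Rightarrow> nat \<Rightarrow> int \<Rightarrow> int" where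
  "Rab_le v k l \<mu> d = (if Rab_set v k l \<mu> d \<noteq> {} then Min (Rab_set v k l \<mu> d) else int v + 1)"

end

theory Submission
  imports Defs
begin

text \<open>Suppose that a \<open>d\<close>-regular induced subgraph had \<open>y\<close> vertices. If \<open>x\<^sub>u\<close> counts the neighbours
  of an outside vertex \<open>u\<close> in it, then \<open>R(x, y, d) = (\<Sum>u. (x - x\<^sub>u) * (x + 1 - x\<^sub>u))\<close>. Nonnegativity of
  this quadratic at the integer below the mean of the \<open>x\<^sub>u\<close> implies that their ``variance'' is
  nonnegative, an inequality in the parameters alone that makes sense for every \<open>y\<close> and \<open>d\<close>. After
  elimination of \<open>\<mu>\<close> by \<open>v \<mu> = (k - \<rho>) (k - \<sigma>)\<close>, it factorises as
  \<open>(y (k - \<sigma>) - v (d - \<sigma>)) (y (k - \<rho>) - v (d - \<rho>)) \<le> 0\<close>, which places \<open>y\<close> between the two Haemers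
  bounds.\<close>

section \<open>Strongly regular graphs\<close>

text \<open>Without parallel arcs \<open>head G\<close> is injective on the out-arcs of a vertex.
  This turns the valency, a number of arcs, into a number of neighbours.\<close>

lemma (in nomulti_digraph) card_out_neighbours:
  "card {b \<in> verts G. a \<rightarrow>\<^bsub>G\<^esub> b} = out_degree G a"
proof -
  have "{b \<in> verts G. a \<rightarrow>\<^bsub>G\<^esub> b} = head G ` out_arcs G a"
    by (auto simp: arcs_ends_conv out_arcs_def)
  moreover have "inj_on (head G) (out_arcs G a)"
    by (rule inj_onI) (auto simp: out_arcs_def arc_to_ends_def intro: no_multi_arcs)
  ultimately show ?thesis
    by (simp add: card_image out_degree_def)
qed

context
  fixes G :: "('a, 'b) pre_digraph" and v k l \<mu> :: nat
  assumes srg: "strongly_regular G v k l \<mu>"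
begin

interpretation graph G
  using srg by (simp add: strongly_regular_def)

lemma srg_card_verts: "card (verts G) = v"
  using srg by (simp add: strongly_regular_def)

lemma srg_valency: "a \<in> verts G \<Longrightarrow> card {b \<in> verts G. a \<rightarrow>\<^bsub>G\<^esub> b} = k"
  using srg by (simp add: strongly_regular_def card_out_neighbours)

lemma srg_edge:
  obtains a b where "a \<in> verts G" "b \<in> verts G" "a \<rightarrow>\<^bsub>G\<^esub> b"
proof -
  obtain e where "e \<in> arcs G"
    using srg by (auto simp: strongly_regular_def)
  then show ?thesis
    by (intro that[of "tail G e" "head G e"]) (auto simp: arcs_ends_conv)
qed

lemma srg_nonedge:
  obtains a b where "a \<in> verts G" "b \<in> verts G" "a \<noteq> b" "\<not> a \<rightarrow>\<^bsub>G\<^esub> b"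
proof -
  have "arcs_ends G \<noteq> {(a, b). (a, b) \<in> verts G \<times> verts G \<and> a \<noteq> b}"
    using srg by (auto simp: strongly_regular_def complete_digraph_def)
  moreover have "arcs_ends G \<subseteq> {(a, b). (a, b) \<in> verts G \<times> verts G \<and> a \<noteq> b}"
    using adj_in_verts adj_not_same by auto
  ultimately show ?thesis
    using that by blast
qed

lemma srg_card_common_neighbours:
  assumes "a \<in> verts G" "b \<in> verts G"
  shows "card (common_neighbours G a b) = (if a = b then k else if a \<rightarrow>\<^bsub>G\<^esub> b then l else \<mu>)"
proof (cases "a = b")
  case True
  then show ?thesis
    using srg_valency[OF assms(1)] by (simp add: common_neighbours_def)
next
  case False
  then show ?thesis
    using srg assms by (simp add: strongly_regular_def)
qed

text \<open>For an edge \<open>a\<close>, \<open>b\<close> the vertex \<open>b\<close> is a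
  neighbour of \<open>a\<close> but not of itself. The consequence \<open>0 < k\<close> later makes
  \<open>k - \<sigma>\<close> positive.\<close>

lemma srg_lambda_less: "l < k"
proof -
  obtain a b where ab: "a \<in> verts G" "b \<in> verts G" "a \<rightarrow>\<^bsub>G\<^esub> b"
    by (rule srg_edge)
  then have "common_neighbours G a b \<subset> {c \<in> verts G. a \<rightarrow>\<^bsub>G\<^esub> c}"
    using adj_not_same by (auto simp: common_neighbours_def)
  then have "card (common_neighbours G a b) < card {c \<in> verts G. a \<rightarrow>\<^bsub>G\<^esub> c}"
    by (intro psubset_card_mono) auto
  moreover have "a \<noteq> b"
    using ab adj_not_same by auto
  ultimately show ?thesis
    using ab srg_valency srg_card_common_neighbours by simp
qed

lemma srg_mu_le: "\<mu> \<le> k"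
proof -
  obtain a b where ab: "a \<in> verts G" "b \<in> verts G" "a \<noteq> b" "\<not> a \<rightarrow>\<^bsub>G\<^esub> b"
    by (rule srg_nonedge)
  have "card (common_neighbours G a b) \<le> card {c \<in> verts G. a \<rightarrow>\<^bsub>G\<^esub> c}"
    by (rule card_mono) (auto simp: common_neighbours_def)
  then show ?thesis
    using ab srg_valency srg_card_common_neighbours by simp
qed

lemma srg_verts_pos: "0 < v"
proof -
  obtain a b where "a \<in> verts G" "b \<in> verts G" "a \<rightarrow>\<^bsub>G\<^esub> b"
    by (rule srg_edge)
  then show ?thesis
    using srg_card_verts finite_verts card_gt_0_iff by blast
qed

text \<open>Both sides count the walks of length two that start at a fixed vertex.\<close>

lemma srg_parameter_identity:
  "int k * (int k - int l - 1) = (int v - int k - 1) * int \<mu>"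
proof -
  obtain a where a: "a \<in> verts G"
    by (rule srg_edge)
  define N where "N = {b \<in> verts G. a \<rightarrow>\<^bsub>G\<^esub> b}"
  define M where "M = verts G - N - {a}"
  have N: "N \<subseteq> verts G" "a \<notin> N" "finite N" "card N = k"
    using srg_valency[OF a] adj_not_same by (auto simp: N_def)
  have M: "finite M" "card M = v - k - 1" "k + 1 \<le> v"
  proof -
    have "card (insert a N) \<le> card (verts G)"
      using N a by (intro card_mono) auto
    then show "k + 1 \<le> v"
      using N srg_card_verts by simp
    show "card M = v - k - 1"
      using N a srg_card_verts by (simp add: M_def card_Diff_subset card_Diff_singleton)
  qed (simp add: M_def)
  have verts: "verts G = insert a (N \<union> M)"
    using a N by (auto simp: M_def)
  \<comment> \<open>Walks \<open>a\<close>, \<open>b\<close>, \<open>c\<close> counted by their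
    middle vertex \<open>b\<close>. Below they are counted by their end \<open>c\<close>, which
    contributes \<open>k\<close>, \<open>l\<close> or \<open>\<mu>\<close> as it is
    \<open>a\<close>, lies in \<open>N\<close> or lies in \<open>M\<close>.\<close>
  have "(\<Sum>c\<in>verts G. card {b \<in> N. c \<rightarrow>\<^bsub>G\<^esub> b}) = (\<Sum>b\<in>N. k)"
  proof (rule sum_multicount_gen, simp, fact N, intro ballI)
    fix b assume "b \<in> N"
    then have "card {c \<in> verts G. b \<rightarrow>\<^bsub>G\<^esub> c} = k"
      using N srg_valency by auto
    moreover have "{c \<in> verts G. c \<rightarrow>\<^bsub>G\<^esub> b} = {c \<in> verts G. b \<rightarrow>\<^bsub>G\<^esub> c}"
      using arcs_ends_symmetric[OF sym_arcs] by auto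
    ultimately show "card {c \<in> verts G. c \<rightarrow>\<^bsub>G\<^esub> b} = k"
      by simp
  qed
  moreover have "{b \<in> N. c \<rightarrow>\<^bsub>G\<^esub> b} = common_neighbours G a c" for c
    by (auto simp: N_def common_neighbours_def)
  ultimately have "(\<Sum>c\<in>verts G. card (common_neighbours G a c)) = k * k"
    using N by simp
  moreover have "(\<Sum>c\<in>verts G. card (common_neighbours G a c)) =
      k + ((\<Sum>c\<in>N. card (common_neighbours G a c)) + (\<Sum>c\<in>M. card (common_neighbours G a c)))"
    using N M srg_card_common_neighbours[OF a a]
    by (subst verts, subst sum.insert) (auto simp: M_def intro!: sum.union_disjoint)
  moreover have "(\<Sum>c\<in>N. card (common_neighbours G a c)) = (\<Sum>c\<in>N. l)"
    using a N by (intro sum.cong) (auto simp: srg_card_common_neighbours N_def)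
  moreover have "(\<Sum>c\<in>M. card (common_neighbours G a c)) = (\<Sum>c\<in>M. \<mu>)"
    using a by (intro sum.cong) (auto simp: srg_card_common_neighbours N_def M_def)
  ultimately have "k * k = k + (k * l + (v - k - 1) * \<mu>)"
    using N M by simp
  then have "int (k * k) = int (k + (k * l + (v - k - 1) * \<mu>))"
    by (rule arg_cong)
  moreover have "int (v - k - 1) = int v - int k - 1"
    using M by simp
  ultimately show ?thesis
    by (simp add: right_diff_distrib)
qed

text \<open>If \<open>\<mu> = 0\<close>, then adjacency or equality is a transitive relation.\<close>

lemma srg_mu_pos_if_connected:
  assumes "Digraph_Component.connected G"
  shows "0 < \<mu>"
proof (rule ccontr)
  assume "\<not> 0 < \<mu>"
  obtain a b where ab: "a \<in> verts G" "b \<in> verts G" "a \<noteq> b" "\<not> a \<rightarrow>\<^bsub>G\<^esub> b"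
    by (rule srg_nonedge)
  have "a \<rightarrow>\<^sup>*\<^bsub>G\<^esub> b"
    using symmetric_connected_imp_strongly_connected[OF sym_arcs assms] ab
    by (auto simp: strongly_connected_def)
  then have "a = b \<or> a \<rightarrow>\<^bsub>G\<^esub> b"
  proof (induction rule: reachable_induct)
    case (step x y)
    show ?case
    proof (rule ccontr)
      assume y: "\<not> (a = y \<or> a \<rightarrow>\<^bsub>G\<^esub> y)"
      \<comment> \<open>If \<open>a = x\<close>, the last step would make \<open>y\<close> adjacent
        to \<open>a\<close>. So \<open>x\<close> is adjacent to both \<open>a\<close> and
        \<open>y\<close>, which are distinct and non-adjacent.\<close>
      have "a \<rightarrow>\<^bsub>G\<^esub> x" "y \<rightarrow>\<^bsub>G\<^esub> x" "x \<in> verts G" "y \<in> verts G"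
        using step y arcs_ends_symmetric[OF sym_arcs] adj_in_verts by auto
      then have "x \<in> common_neighbours G a y"
        by (simp add: common_neighbours_def)
      moreover have "finite (common_neighbours G a y)"
        by (simp add: common_neighbours_def)
      ultimately have "card (common_neighbours G a y) \<noteq> 0"
        by auto
      then show False
        using srg_card_common_neighbours[OF ab(1) \<open>y \<in> verts G\<close>] y \<open>\<not> 0 < \<mu>\<close> by simp
    qed
  qed simp
  with ab show False
    by simp
qed

end

section \<open>Restricted eigenvalues\<close>

lemma restricted_eigenvalues_sum_prod:
  assumes "restricted_eigenvalues k l \<mu> \<rho> \<sigma>"
  shows "\<rho> + \<sigma> = real l - real \<mu>" and "\<rho> * \<sigma> = real \<mu> - real k"
proof -
  have "\<rho> \<noteq> \<sigma>"
    and "\<rho>\<^sup>2 - (real l - real \<mu>) * \<rho> - (real k - real \<mu>) = 0"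
    and "\<sigma>\<^sup>2 - (real l - real \<mu>) * \<sigma> - (real k - real \<mu>) = 0"
    using assms by (auto simp: restricted_eigenvalues_def)
  moreover from this have "(\<rho> - \<sigma>) * (\<rho> + \<sigma> - (real l - real \<mu>)) = 0"
    by (simp add: algebra_simps power2_eq_square)
  ultimately show sum: "\<rho> + \<sigma> = real l - real \<mu>"
    by simp
  have "\<rho>\<^sup>2 - (\<rho> + \<sigma>) * \<rho> - (real k - real \<mu>) = 0"
    unfolding sum by fact
  then show "\<rho> * \<sigma> = real \<mu> - real k"
    by (simp add: algebra_simps power2_eq_square)
qed

text \<open>The left side is the quadratic with roots \<rho> and \<sigma>, evaluated at
  \<open>k\<close>; the parameter identity then removes \<open>l\<close>.\<close>

lemma srg_eigenvalue_identity:
  assumes "strongly_regular G v k l \<mu>" and "restricted_eigenvalues k l \<mu> \<rho> \<sigma>"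
  shows "(real k - \<rho>) * (real k - \<sigma>) = real v * real \<mu>"
proof -
  have "(real k - \<rho>) * (real k - \<sigma>) = real k * real k - (\<rho> + \<sigma>) * real k + \<rho> * \<sigma>"
    by (simp add: algebra_simps)
  also have "\<dots> = real k * (real k - real l - 1) + real k * real \<mu> + real \<mu>"
    unfolding restricted_eigenvalues_sum_prod[OF assms(2)] by (simp add: algebra_simps)
  also have "real k * (real k - real l - 1) = (real v - real k - 1) * real \<mu>"
    using arg_cong[OF srg_parameter_identity[OF assms(1)], of real_of_int] by simp
  finally show ?thesis
    by (simp add: algebra_simps)
qed

text \<open>The signs are read off the products \<rho>\<sigma> = \<mu> - k and (k - \<rho>)(k -
  \<sigma>) = v\<mu>. Connectedness makes the second one positive.\<close>

lemma srg_eigenvalue_bounds: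
  assumes "strongly_regular G v k l \<mu>" and "restricted_eigenvalues k l \<mu> \<rho> \<sigma>"
  shows "\<sigma> \<le> 0" and "\<sigma> < real k" and "\<rho> \<le> real k"
    and "Digraph_Component.connected G \<Longrightarrow> \<rho> < real k"
proof -
  note sum_prod = restricted_eigenvalues_sum_prod[OF assms(2)]
  note prod = srg_eigenvalue_identity[OF assms]
  have gt: "\<sigma> < \<rho>"
    using assms(2) by (simp add: restricted_eigenvalues_def)
  have "\<rho> * \<sigma> \<le> 0"
    using sum_prod srg_mu_le[OF assms(1)] by simp
  then show "\<sigma> \<le> 0"
    using gt mult_pos_pos[of \<rho> \<sigma>] by linarith
  then show "\<sigma> < real k"
    using srg_lambda_less[OF assms(1)] by simp
  then have *: "0 < real k - \<sigma>"
    by simp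
  have "0 \<le> (real k - \<rho>) * (real k - \<sigma>)"
    by (simp add: prod)
  with * show "\<rho> \<le> real k"
    by (simp add: zero_le_mult_iff)
  assume "Digraph_Component.connected G"
  then have "0 < (real k - \<rho>) * (real k - \<sigma>)"
    using srg_mu_pos_if_connected[OF assms(1)] srg_verts_pos[OF assms(1)] by (simp add: prod)
  with * show "\<rho> < real k"
    by (simp add: zero_less_mult_iff)
qed

section \<open>The regular adjacency polynomial\<close>

text \<open>In the counting picture \<open>a\<close> is the number of outside vertices
  \<open>u\<close>, \<open>b\<close> is the sum of the \<open>x\<^sub>u\<close>, and
  \<open>b + c\<close> is the sum of their squares.\<close>

lemma integer_quadratic_nonneg_imp_variance_nonneg:
  fixes a b c :: int
  assumes "0 < a" and "\<And>x. 0 \<le> x * (x + 1) * a - 2 * x * b + c"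
  shows "b\<^sup>2 \<le> a * (b + c)"
proof -
  define x r where "x = b div a" and "r = b mod a"
  have b: "b = a * x + r" and r: "0 \<le> r" "r < a"
    using assms(1) by (simp_all add: x_def r_def)
  \<comment> \<open>Taking \<open>x\<close> to be the mean \<open>b / a\<close> rounded down leaves
    the error \<open>r * (a - r)\<close>, which is nonnegative because
    \<open>0 \<le> r < a\<close>.\<close>
  have "a * (b + c) - b\<^sup>2 = a * (x * (x + 1) * a - 2 * x * b + c) + r * (a - r)"
    by (simp add: b algebra_simps power2_eq_square)
  also have "\<dots> \<ge> 0"
    using assms(1) assms(2)[of x] r by simp
  finally show ?thesis
    by simp
qed

lemma Rab_set_factorised:
  assumes srg: "strongly_regular G v k l \<mu>" and ev: "restricted_eigenvalues k l \<mu> \<rho> \<sigma>"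
    and d: "0 \<le> d" "d \<le> int k" and y: "y \<in> Rab_set v k l \<mu> d" "y \<noteq> int v"
  shows "(y * (real k - \<sigma>) - real v * (d - \<sigma>)) * (y * (real k - \<rho>) - real v * (d - \<rho>)) \<le> 0"
proof -
  \<comment> \<open>Chosen so that \<open>y * q\<close> is the sum of squares \<open>b + c\<close>
    for the coefficients of \<open>R\<close>; the common factor \<open>y\<close> then
    cancels.\<close>
  define q where "q = (int l - int \<mu>) * d + int k - int \<mu> + y * int \<mu> - d\<^sup>2"
  have y': "0 < y" "y < int v" and R: "0 \<le> regular_adj_poly v k l \<mu> x y d" for x
    using d y by (auto simp: Rab_set_def)
  have "(y * (int k - d))\<^sup>2 \<le> (int v - y) * (y * (int k - d)
      + ((int l - int \<mu> + 1) * y * d + y * (y - 1) * int \<mu> - y * d\<^sup>2))"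
  proof (rule integer_quadratic_nonneg_imp_variance_nonneg)
    show "0 \<le> x * (x + 1) * (int v - y) - 2 * x * (y * (int k - d))
        + ((int l - int \<mu> + 1) * y * d + y * (y - 1) * int \<mu> - y * d\<^sup>2)" for x
      using R[of x] by (simp add: regular_adj_poly_def algebra_simps)
  qed (use y' in simp)
  then have "y * (y * (int k - d)\<^sup>2) \<le> y * ((int v - y) * q)"
    by (simp add: q_def algebra_simps power2_eq_square)
  then have "y * (int k - d)\<^sup>2 \<le> (int v - y) * q"
    using y' by simp
  then have "real_of_int (y * (int k - d)\<^sup>2) \<le> real_of_int ((int v - y) * q)"
    by (simp only: of_int_le_iff)
  then have var: "y * (real k - d)\<^sup>2 \<le> (real v - y) * real_of_int q"
    by simp
  have "real_of_int q = (real l - real \<mu>) * d - (real \<mu> - real k) + y * real \<mu> - (real_of_int d)\<^sup>2"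
    by (simp add: q_def)
  also have "\<dots> = y * real \<mu> - (d - \<rho>) * (d - \<sigma>)"
    by (simp flip: restricted_eigenvalues_sum_prod[OF ev]) (simp add: algebra_simps power2_eq_square)
  finally have q: "real_of_int q = y * real \<mu> - (d - \<rho>) * (d - \<sigma>)" .
  \<comment> \<open>A polynomial identity: the last summand is the multiple of the relation (k -
    \<rho>)(k - \<sigma>) = v\<mu> needed to eliminate \<mu>.\<close>
  have "(y * (real k - \<sigma>) - real v * (d - \<sigma>)) * (y * (real k - \<rho>) - real v * (d - \<rho>))
      = real v * (y * (real k - d)\<^sup>2 - (real v - y) * real_of_int q)
        + (real_of_int y * y - y * real v) * ((real k - \<rho>) * (real k - \<sigma>) - real v * real \<mu>)"
    unfolding q by (simp add: algebra_simps power2_eq_square)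
  also have "\<dots> = real v * (y * (real k - d)\<^sup>2 - (real v - y) * real_of_int q)"
    using srg_eigenvalue_identity[OF srg ev] by simp
  also have "\<dots> \<le> 0"
    using var by (intro mult_nonneg_nonpos) auto
  finally show ?thesis .
qed

text \<open>For \<open>y = v\<close> the polynomial is linear in \<open>x\<close> with slope \<open>2 v (d - k)\<close>.\<close>

lemma verts_in_Rab_set:
  assumes "0 < v" and "int v \<in> Rab_set v k l \<mu> d"
  shows "d = int k"
proof (rule ccontr)
  assume "d \<noteq> int k"
  define s c where "s = 2 * int v * (d - int k)"
    and "c = regular_adj_poly v k l \<mu> 0 (int v) d"
  have R: "regular_adj_poly v k l \<mu> x (int v) d = x * s + c" for x
    by (simp add: regular_adj_poly_def s_def c_def algebra_simps)
  have "s \<noteq> 0"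
    using assms(1) \<open>d \<noteq> int k\<close> by (simp add: s_def)
  have "0 \<le> x * s + c" for x
    using assms(2) by (simp add: Rab_set_def flip: R)
  \<comment> \<open>At this argument the linear term is
    \<open>- s\<^sup>2 * (\<bar>c\<bar> + 1)\<close>, too negative for \<open>c\<close> to
    compensate.\<close>
  from this[of "- s * (\<bar>c\<bar> + 1)"] have "s\<^sup>2 * (\<bar>c\<bar> + 1) \<le> c"
    by (simp add: algebra_simps power2_eq_square)
  moreover have "1 * (\<bar>c\<bar> + 1) \<le> s\<^sup>2 * (\<bar>c\<bar> + 1)"
    using \<open>s \<noteq> 0\<close> by (intro mult_right_mono) (auto simp: int_one_le_iff_zero_less)
  ultimately have "1 * (\<bar>c\<bar> + 1) \<le> c"
    by (rule order_trans[rotated])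
  then show False
    by simp
qed

section \<open>Comparison with the Haemers bounds\<close>

text \<open>Here the eigenvalue occurs only in one denominator, so monotonicity in it and the value
  \<open>v\<close> at \<open>d = k\<close> are visible.\<close>

lemma Haem_ge_alt:
  assumes "\<sigma> < real k"
  shows "Haem_ge v k \<sigma> d = v - v * ((real k - d) / (real k - \<sigma>))"
  using assms by (simp add: Haem_ge_def field_simps)

lemma Haem_le_alt:
  assumes "\<rho> < real k"
  shows "Haem_le v k \<rho> d = v - v * ((real k - d) / (real k - \<rho>))"
  using assms by (simp add: Haem_le_def field_simps)

lemma Haem_le_le_Haem_ge:
  assumes "\<sigma> < \<rho>" "\<rho> < real k" "d \<le> int k"
  shows "Haem_le v k \<rho> d \<le> Haem_ge v k \<sigma> d"
proof -
  have "real_of_int d \<le> real k"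
    using assms(3) by linarith
  then show ?thesis
    using assms by (auto simp: Haem_le_alt Haem_ge_alt intro!: mult_left_mono divide_left_mono)
qed

lemma Rab_set_le_Haem_ge:
  assumes srg: "strongly_regular G v k l \<mu>" and ev: "restricted_eigenvalues k l \<mu> \<rho> \<sigma>"
    and d: "0 \<le> d" "d \<le> int k" and y: "y \<in> Rab_set v k l \<mu> d"
  shows "real_of_int y \<le> Haem_ge v k \<sigma> d"
proof -
  note bounds = srg_eigenvalue_bounds[OF srg ev]
  have pos: "0 < real k - \<sigma>" and v: "0 < v" and gt: "\<sigma> < \<rho>"
    using bounds srg_verts_pos[OF srg] ev by (auto simp: restricted_eigenvalues_def)
  \<comment> \<open>The factorisation excludes \<open>y = v\<close>, which can occur only for
    \<open>d = k\<close>, where the bound is \<open>v\<close> itself.\<close>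
  consider "d = int k" | "d < int k" "y \<noteq> int v"
    using verts_in_Rab_set[OF v] y d by force
  then show ?thesis
  proof cases
    case 1
    then have "Haem_ge v k \<sigma> d = v"
      using bounds by (simp add: Haem_ge_alt)
    then show ?thesis
      using y by (auto simp: Rab_set_def)
  next
    case 2
    have dk: "real_of_int d < real k"
      using 2 by linarith
    have prod: "(y * (real k - \<sigma>) - v * (d - \<sigma>)) * (y * (real k - \<rho>) - v * (d - \<rho>)) \<le> 0"
      using Rab_set_factorised[OF srg ev d y 2(2)] .
    \<comment> \<open>Without connectedness \<open>k - \<rho>\<close> may vanish, so nothing is
      divided by it. A positive first factor would give (v - y)(k - \<sigma>) < v(k - d) \<le> (v -
      y)(k - \<rho>), against \<sigma> < \<rho>.\<close>
    have "y * (real k - \<sigma>) \<le> v * (d - \<sigma>)"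
    proof (rule ccontr)
      assume "\<not> y * (real k - \<sigma>) \<le> v * (d - \<sigma>)"
      then have *: "v * (d - \<sigma>) < y * (real k - \<sigma>)"
        by simp
      have "y * (real k - \<rho>) \<le> v * (d - \<rho>)"
        using prod * by (simp add: mult_le_0_iff)
      then have "(real v - y) * (real k - \<rho>) \<ge> v * (real k - d)"
        by (simp add: algebra_simps)
      moreover have "(real v - y) * (real k - \<sigma>) < v * (real k - d)"
        using * by (simp add: algebra_simps)
      moreover have "(real v - y) * (real k - \<rho>) \<le> (real v - y) * (real k - \<sigma>)"
        using gt y by (intro mult_left_mono) (auto simp: Rab_set_def)
      ultimately show False
        by linarith
    qed
    then show ?thesis
      using pos by (simp add: Haem_ge_def pos_le_divide_eq)
  qed
qed

lemma Haem_le_le_Rab_set: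
  assumes srg: "strongly_regular G v k l \<mu>" and ev: "restricted_eigenvalues k l \<mu> \<rho> \<sigma>"
    and conn: "Digraph_Component.connected G"
    and d: "0 \<le> d" "d \<le> int k" and y: "y \<in> Rab_set v k l \<mu> d"
  shows "Haem_le v k \<rho> d \<le> real_of_int y"
proof (cases "y = int v")
  case True
  then have "d = int k"
    using verts_in_Rab_set srg_verts_pos[OF srg] y by blast
  then show ?thesis
    using True srg_eigenvalue_bounds(4)[OF srg ev conn] by (simp add: Haem_le_alt)
next
  case False
  note bounds = srg_eigenvalue_bounds[OF srg ev]
  have pos: "0 < real k - \<sigma>" "0 < real k - \<rho>" and gt: "\<sigma> < \<rho>"
    using bounds conn ev by (auto simp: restricted_eigenvalues_def)
  \<comment> \<open>A \<open>y\<close> below the lower bound would have to lie above the upper one,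
    contradicting the order of the two bounds.\<close>
  have "y * (real k - \<rho>) < v * (d - \<rho>) \<Longrightarrow> v * (d - \<sigma>) \<le> y * (real k - \<sigma>)"
    using Rab_set_factorised[OF srg ev d y False] by (simp add: mult_le_0_iff)
  moreover have "Haem_le v k \<rho> d \<le> real_of_int y \<longleftrightarrow> v * (d - \<rho>) \<le> y * (real k - \<rho>)"
    and "Haem_ge v k \<sigma> d \<le> real_of_int y \<longleftrightarrow> v * (d - \<sigma>) \<le> y * (real k - \<sigma>)"
    using pos by (simp_all add: Haem_le_def Haem_ge_def pos_divide_le_eq)
  moreover have "Haem_le v k \<rho> d \<le> Haem_ge v k \<sigma> d"
    using Haem_le_le_Haem_ge[OF gt _ d(2)] pos by simp
  ultimately show ?thesis
    by linarith
qed

lemma finite_Rab_set: "finite (Rab_set v k l \<mu> d)"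
  by (rule finite_subset[of _ "{d + 1..int v}"]) (auto simp: Rab_set_def)

theorem theorem5p5:
  fixes G :: "('a, 'b) pre_digraph" and v k l \<mu> :: nat and \<rho> \<sigma> :: real and d :: int
  assumes "strongly_regular G v k l \<mu>"
    and "restricted_eigenvalues k l \<mu> \<rho> \<sigma>"
    and "0 \<le> d" and "d \<le> int k"
  shows "Rab_ge v k l \<mu> d \<le> \<lfloor>Haem_ge v k \<sigma> d\<rfloor> \<and>
    (Digraph_Component.connected G \<longrightarrow> Rab_le v k l \<mu> d \<ge> \<lceil>Haem_le v k \<rho> d\<rceil>)"
proof (intro conjI impI)
  \<comment> \<open>This covers the default value \<open>0\<close> of \<open>Rab_ge\<close> when
    \<open>Rab_set\<close> is empty.\<close>
  have "0 \<le> Haem_ge v k \<sigma> d"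
    using srg_eigenvalue_bounds[OF assms(1,2)] assms(3) by (simp add: Haem_ge_def)
  moreover have "y \<le> \<lfloor>Haem_ge v k \<sigma> d\<rfloor>" if "y \<in> Rab_set v k l \<mu> d" for y
    using Rab_set_le_Haem_ge[OF assms that] by (simp add: le_floor_iff)
  ultimately show "Rab_ge v k l \<mu> d \<le> \<lfloor>Haem_ge v k \<sigma> d\<rfloor>"
    by (simp add: Rab_ge_def finite_Rab_set)
next
  assume conn: "Digraph_Component.connected G"
  have "real_of_int d \<le> real k"
    using assms(4) by linarith
  then have "Haem_le v k \<rho> d \<le> v"
    using srg_eigenvalue_bounds(4)[OF assms(1,2) conn] by (simp add: Haem_le_alt)
  \<comment> \<open>This covers the default value \<open>v + 1\<close> of \<open>Rab_le\<close> when
    \<open>Rab_set\<close> is empty.\<close>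
  then have "\<lceil>Haem_le v k \<rho> d\<rceil> \<le> int v + 1"
    by (simp add: ceiling_le_iff)
  moreover have "\<lceil>Haem_le v k \<rho> d\<rceil> \<le> y" if "y \<in> Rab_set v k l \<mu> d" for y
    using Haem_le_le_Rab_set[OF assms(1,2) conn assms(3,4) that] by (simp add: ceiling_le_iff)
  ultimately show "Rab_le v k l \<mu> d \<ge> \<lceil>Haem_le v k \<rho> d\<rceil>"
    by (simp add: Rab_le_def finite_Rab_set)
qed

end
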